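(* Let $X$ be a partially ordered vector space, with order topology $\tau_o$ and order bound topology $\tau_{ob}$. (1) If $X$ is Archimedean and there are order units in $X$, then the order bound topology is finer than the order topology, i.e. $\tau_o\subseteq\tau_{ob}$. (2) If there are net catching elements in $X$, then the order topology is finer than the order bound topology, i.e. $\tau_{ob}\subseteq\tau_o$.
   Context: A partially ordered vector space is a real vector space $X$ with a partial order $\leq$ such that $x\leq y$ implies $x+z\leq y+z$ and $\lambda x\leq\lambda y$ for all $z\in X$ and real $\lambda\geq 0$; $X_+=\{x\in X;\ x\geq 0\}$, and order intervals are the sets $[x,y]=\{z\in X;\ x\leq z\leq y\}$. $X$ is Archimedean if for all $x,y\in X$ with $nx\leq y$ for all $n\in\mathbb{N}$ one has $x\leq 0$. An element $u\in X_+$ is an order unit if for every $x\in X$ there is $n\in\mathbb{N}$ with $x\leq nu$. For a net $(x_\alpha)_{\alpha\in A}$ in $X$ we write $x_\alpha\downarrow 0$ if the net is decreasing ($\alpha\leq\beta$ implies $x_\beta\leq x_\alpha$) and $\inf_{\alpha\in A} x_\alpha=0$. A set $M\subseteq X$ is net catching for $x\in X$ if for every net $(x_\alpha)_{\alpha\in A}$ in $X$ with $x_\alpha\downarrow 0$ there is $\alpha\in A$ with $[x-x_\alpha,x+x_\alpha]\subseteq M$. A set $O\subseteq X$ is order open if it is net catching for every $x\in O$. The order topology is $\tau_o=\{O\subseteq X;\ O\text{ order open}\}$. An element $y\in X$ is called net catching if for every net $(x_\alpha)_{\alpha\in A}$ in $X$ with $x_\alpha\downarrow 0$ there is $\alpha\in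 A$ with $x_\alpha\leq y$. A set $M\subseteq X$ is circled if $\lambda M\subseteq M$ for all $\lambda\in[-1,1]$; $M$ absorbs $N\subseteq X$ if there is $\mu>0$ with $\lambda N\subseteq M$ for all $\lambda\in[-\mu,\mu]$. Let $\mathcal{B}_{ob}$ be the set of all convex, circled $V\subseteq X$ that absorb all order intervals. The order bound topology $\tau_{ob}$ is the vector space topology on $X$ for which $\mathcal{B}_{ob}$ is a base of neighbourhoods at $0$. *)

theory Defs
  imports "HOL-Analysis.Analysis" "HOL-Library.Lub_Glb"
begin

text \<open>Partially ordered vector spaces are the types of class
  \<^class>\<open>ordered_real_vector\<close>.\<close>

definition archimedean_space :: "'a::ordered_real_vector itself \<Rightarrow> bool" where
  "archimedean_space _ \<longleftrightarrow>
     (\<forall>x y :: 'a. (\<forall>n::nat. real n *\<^sub>R x \<le> y) \<longrightarrow> x \<le> 0)"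

definition order_unit :: "'a::ordered_real_vector \<Rightarrow> bool" where
  "order_unit u \<longleftrightarrow> 0 \<le> u \<and> (\<forall>x. \<exists>n::nat. x \<le> real n *\<^sub>R u)"

section \<open>The order topology\<close>

text \<open>A net is a family \<open>f\<close> over a directed set: a nonempty index set \<open>A\<close> with a preorder \<open>r\<close>,
  where \<open>(\<alpha>, \<beta>) \<in> r\<close> means \<open>\<alpha> \<le> \<beta>\<close>.\<close>

definition directed_set :: "'i set \<Rightarrow> 'i rel \<Rightarrow> bool" where
  "directed_set A r \<longleftrightarrow>
     A \<noteq> {} \<and> preorder_on A r \<and> (\<forall>\<alpha>\<in>A. \<forall>\<beta>\<in>A. \<exists>\<gamma>\<in>A. (\<alpha>, \<gamma>) \<in> r \<and> (\<beta>, \<gamma>) \<in> r)"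

definition net_decreasing_to_0 :: "'i set \<Rightarrow> 'i rel \<Rightarrow> ('i \<Rightarrow> 'a::ordered_real_vector) \<Rightarrow> bool" where
  "net_decreasing_to_0 A r f \<longleftrightarrow>
     directed_set A r \<and> (\<forall>(\<alpha>, \<beta>) \<in> r. f \<beta> \<le> f \<alpha>) \<and> isGlb UNIV (f ` A) 0"

text \<open>HOL cannot quantify over the type of the indices inside a definition, so the next two
  definitions let the nets be indexed by subsets of \<^typ>\<open>'a\<close>, with arbitrary directed preorders.
  This is no restriction: the lemmas \<open>net_catching_forD\<close> and \<open>net_catching_elementD\<close> below give
  the same property for nets over any index type.\<close>

definition net_catching_for :: "'a::ordered_real_vector set \<Rightarrow> 'a \<Rightarrow> bool" where
  "net_catching_for M x \<longleftrightarrow>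
     (\<forall>(A :: 'a set) r (f :: 'a \<Rightarrow> 'a). net_decreasing_to_0 A r f \<longrightarrow>
        (\<exists>\<alpha>\<in>A. {x - f \<alpha> .. x + f \<alpha>} \<subseteq> M))"

definition net_catching_element :: "'a::ordered_real_vector \<Rightarrow> bool" where
  "net_catching_element y \<longleftrightarrow>
     (\<forall>(A :: 'a set) r (f :: 'a \<Rightarrow> 'a). net_decreasing_to_0 A r f \<longrightarrow> (\<exists>\<alpha>\<in>A. f \<alpha> \<le> y))"

lemma net_decreasing_to_0_range:
  assumes "net_decreasing_to_0 A r f"
  shows "net_decreasing_to_0 (f ` A) {(a, b). a \<in> f ` A \<and> b \<in> f ` A \<and> b \<le> a} id"
proof -
  have "\<exists>\<gamma>\<in>A. f \<gamma> \<le> f \<alpha> \<and> f \<gamma> \<le> f \<beta>" if "\<alpha> \<in> A" "\<beta> \<in> A" for \<alpha> \<beta>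
    using assms that unfolding net_decreasing_to_0_def directed_set_def by blast
  moreover have "A \<noteq> {}" "isGlb UNIV (f ` A) 0"
    using assms by (auto simp: net_decreasing_to_0_def directed_set_def)
  ultimately show ?thesis
    unfolding net_decreasing_to_0_def directed_set_def
    by (auto simp: preorder_on_def refl_on_def trans_def)
qed

lemma net_catching_forD:
  fixes A :: "'i set"
  assumes "net_catching_for M x" "net_decreasing_to_0 A r f"
  shows "\<exists>\<alpha>\<in>A. {x - f \<alpha> .. x + f \<alpha>} \<subseteq> M"
proof -
  obtain a where "a \<in> f ` A" "{x - id a .. x + id a} \<subseteq> M"
    using assms(1) net_decreasing_to_0_range[OF assms(2)] unfolding net_catching_for_def by blast
  then show ?thesis by auto
qed

lemma net_catching_elementD:
  fixes A :: "'i set"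
  assumes "net_catching_element y" "net_decreasing_to_0 A r f"
  shows "\<exists>\<alpha>\<in>A. f \<alpha> \<le> y"
proof -
  obtain a where "a \<in> f ` A" "id a \<le> y"
    using assms(1) net_decreasing_to_0_range[OF assms(2)] unfolding net_catching_element_def by blast
  then show ?thesis by auto
qed

definition order_open :: "'a::ordered_real_vector set \<Rightarrow> bool" where
  "order_open U \<longleftrightarrow> (\<forall>x\<in>U. net_catching_for U x)"

definition tau_o :: "'a::ordered_real_vector topology" where
  "tau_o = topology order_open"

lemma istopology_order_open: "istopology (order_open :: 'a::ordered_real_vector set \<Rightarrow> bool)"
proof -
  have "net_catching_for (S \<inter> T) x" if S: "net_catching_for S x" and T: "net_catching_for T x"
    for S T and x :: 'a
    unfolding net_catching_for_def
  proof (intro allI impI)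
    fix A :: "'a set" and r and f :: "'a \<Rightarrow> 'a"
    assume net: "net_decreasing_to_0 A r f"
    obtain \<alpha> where \<alpha>: "\<alpha> \<in> A" "{x - f \<alpha> .. x + f \<alpha>} \<subseteq> S" using net_catching_forD[OF S net] by blast
    obtain \<beta> where \<beta>: "\<beta> \<in> A" "{x - f \<beta> .. x + f \<beta>} \<subseteq> T" using net_catching_forD[OF T net] by blast
    obtain \<gamma> where \<gamma>: "\<gamma> \<in> A" "f \<gamma> \<le> f \<alpha>" "f \<gamma> \<le> f \<beta>"
      using net \<alpha>(1) \<beta>(1) unfolding net_decreasing_to_0_def directed_set_def by blast
    have "{x - f \<gamma> .. x + f \<gamma>} \<subseteq> {x - f \<alpha> .. x + f \<alpha>}" "{x - f \<gamma> .. x + f \<gamma>} \<subseteq> {x - f \<beta> .. x + f \<beta>}"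
      by (simp_all add: atLeastatMost_subset_iff \<gamma>)
    with \<alpha> \<beta> \<gamma>(1) show "\<exists>\<alpha>\<in>A. {x - f \<alpha> .. x + f \<alpha>} \<subseteq> S \<inter> T" by blast
  qed
  moreover have "net_catching_for (\<Union>K) x" if "S \<in> K" "net_catching_for S x" for K S and x :: 'a
    using that unfolding net_catching_for_def by (meson Union_upper order_trans)
  ultimately show ?thesis
    unfolding istopology_def order_open_def by (metis IntE UnionE)
qed

lemma openin_tau_o: "openin tau_o U \<longleftrightarrow> order_open U"
  by (simp add: tau_o_def istopology_order_open)

section \<open>The order bound topology\<close>

definition circled :: "'a::real_vector set \<Rightarrow> bool" where
  "circled M \<longleftrightarrow> (\<forall>c\<in>{-1..1::real}. (\<lambda>x. c *\<^sub>R x) ` M \<subseteq> M)"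

definition absorbs :: "'a::real_vector set \<Rightarrow> 'a set \<Rightarrow> bool" where
  "absorbs M N \<longleftrightarrow> (\<exists>\<mu>>0::real. \<forall>c\<in>{-\<mu>..\<mu>}. (\<lambda>x. c *\<^sub>R x) ` N \<subseteq> M)"

definition B_ob :: "'a::ordered_real_vector set set" where
  "B_ob = {V. convex V \<and> circled V \<and> (\<forall>x y. absorbs V {x..y})}"

definition vector_topology :: "'a::real_vector topology \<Rightarrow> bool" where
  "vector_topology T \<longleftrightarrow>
     topspace T = UNIV \<and>
     continuous_map (prod_topology T T) T (\<lambda>(x, y). x + y) \<and>
     continuous_map (prod_topology euclideanreal T) T (\<lambda>(c, x). c *\<^sub>R x)"

text \<open>The library notion \<^const>\<open>neighbourhood_base_at\<close> only says that the sets of the family that are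
  neighbourhoods form a base; the second conjunct says that all of them are neighbourhoods.\<close>

definition has_zero_nhds_base :: "'a::real_vector set set \<Rightarrow> 'a topology \<Rightarrow> bool" where
  "has_zero_nhds_base B T \<longleftrightarrow>
     neighbourhood_base_at 0 (\<lambda>V. V \<in> B) T \<and> (\<forall>V\<in>B. \<exists>U. openin T U \<and> 0 \<in> U \<and> U \<subseteq> V)"

text \<open>Existence and uniqueness are the lemma \<open>ex1_tau_ob\<close> below.\<close>

definition tau_ob :: "'a::ordered_real_vector topology" where
  "tau_ob = (THE T. vector_topology T \<and> has_zero_nhds_base B_ob T)"

lemma B_ob_circledD: "V \<in> B_ob \<Longrightarrow> \<bar>c\<bar> \<le> 1 \<Longrightarrow> v \<in> V \<Longrightarrow> c *\<^sub>R v \<in> V"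
  unfolding B_ob_def circled_def by (auto simp: abs_le_iff image_subset_iff)

lemma B_ob_absorbs_point:
  assumes "V \<in> B_ob"
  obtains \<mu> where "\<mu> > 0" "\<And>c. \<bar>c\<bar> \<le> \<mu> \<Longrightarrow> c *\<^sub>R x \<in> V"
proof -
  have "absorbs V {x..x}" using assms unfolding B_ob_def by blast
  then obtain \<mu> where "\<mu> > 0" "\<forall>c\<in>{-\<mu>..\<mu>}. c *\<^sub>R x \<in> V" unfolding absorbs_def by auto
  then show thesis by (intro that[of \<mu>]) (auto simp: abs_le_iff)
qed

lemma zero_in_B_ob:
  assumes "V \<in> B_ob" shows "0 \<in> V"
proof -
  obtain \<mu> where "\<mu> > 0" "\<And>c. \<bar>c\<bar> \<le> \<mu> \<Longrightarrow> c *\<^sub>R 0 \<in> V"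
    by (rule B_ob_absorbs_point[OF assms, where x = 0]) blast
  from this(2)[of 0] this(1) show ?thesis by simp
qed

lemma B_ob_UNIV: "UNIV \<in> B_ob"
  unfolding B_ob_def circled_def absorbs_def by (auto intro: exI[of _ 1])

lemma B_ob_Int:
  assumes "V \<in> B_ob" "W \<in> B_ob" shows "V \<inter> W \<in> B_ob"
proof -
  have "absorbs (V \<inter> W) {x..y}" for x y
  proof -
    have "absorbs V {x..y}" "absorbs W {x..y}" using assms unfolding B_ob_def by blast+
    then obtain \<mu> \<nu> where *: "\<mu> > 0" "\<forall>c\<in>{-\<mu>..\<mu>}. (\<lambda>z. c *\<^sub>R z) ` {x..y} \<subseteq> V"
      "\<nu> > 0" "\<forall>c\<in>{-\<nu>..\<nu>}. (\<lambda>z. c *\<^sub>R z) ` {x..y} \<subseteq> W" unfolding absorbs_def by blast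
    show ?thesis unfolding absorbs_def
    proof (intro exI[of _ "min \<mu> \<nu>"] conjI ballI)
      fix c assume "c \<in> {- min \<mu> \<nu> .. min \<mu> \<nu>}"
      then have "c \<in> {-\<mu>..\<mu>}" "c \<in> {-\<nu>..\<nu>}" by auto
      then show "(\<lambda>z. c *\<^sub>R z) ` {x..y} \<subseteq> V \<inter> W" using * by blast
    qed (use * in auto)
  qed
  moreover have "circled (V \<inter> W)" using assms unfolding B_ob_def circled_def by blast
  ultimately show ?thesis using assms unfolding B_ob_def by (auto intro: convex_Int)
qed

lemma B_ob_scale:
  assumes "V \<in> B_ob" "r > 0" shows "(\<lambda>x. r *\<^sub>R x) ` V \<in> B_ob"
proof -
  have "absorbs ((\<lambda>x. r *\<^sub>R x) ` V) {x..y}" for x y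
  proof -
    have "absorbs V {x..y}" using assms unfolding B_ob_def by blast
    then obtain \<mu> where *: "\<mu> > 0" "\<forall>c\<in>{-\<mu>..\<mu>}. (\<lambda>z. c *\<^sub>R z) ` {x..y} \<subseteq> V"
      unfolding absorbs_def by blast
    show ?thesis unfolding absorbs_def
    proof (intro exI[of _ "r * \<mu>"] conjI ballI subsetI)
      fix c z assume c: "c \<in> {- (r * \<mu>) .. r * \<mu>}" and "z \<in> (\<lambda>z. c *\<^sub>R z) ` {x..y}"
      then obtain w where w: "w \<in> {x..y}" "z = c *\<^sub>R w" by auto
      have "c / r \<in> {-\<mu>..\<mu>}" using c assms(2) by (auto simp: field_simps)
      then have "(c / r) *\<^sub>R w \<in> V" using * w(1) by blast
      moreover have "z = r *\<^sub>R ((c / r) *\<^sub>R w)" using w assms(2) by simp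
      ultimately show "z \<in> (\<lambda>x. r *\<^sub>R x) ` V" by blast
    qed (use * assms in auto)
  qed
  moreover have "circled ((\<lambda>x. r *\<^sub>R x) ` V)"
    unfolding circled_def
  proof (intro ballI subsetI)
    fix c :: real and z assume "c \<in> {-1..1}" "z \<in> (\<lambda>x. c *\<^sub>R x) ` (\<lambda>x. r *\<^sub>R x) ` V"
    then obtain v where "v \<in> V" "z = r *\<^sub>R (c *\<^sub>R v)" "\<bar>c\<bar> \<le> 1"
      by (auto simp: scaleR_left_commute abs_le_iff)
    then show "z \<in> (\<lambda>x. r *\<^sub>R x) ` V" using B_ob_circledD[OF assms(1)] by blast
  qed
  moreover have "convex ((\<lambda>x. r *\<^sub>R x) ` V)"
    using assms unfolding B_ob_def by (auto intro: convex_scaling)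
  ultimately show ?thesis unfolding B_ob_def by blast
qed

lemma B_ob_half:
  assumes "V \<in> B_ob"
  obtains W where "W \<in> B_ob" "\<And>v w. v \<in> W \<Longrightarrow> w \<in> W \<Longrightarrow> v + w \<in> V"
proof (rule that)
  show "(\<lambda>x. (1/2) *\<^sub>R x) ` V \<in> B_ob" using assms by (intro B_ob_scale) auto
  fix v w assume "v \<in> (\<lambda>x. (1/2) *\<^sub>R x) ` V" "w \<in> (\<lambda>x. (1/2) *\<^sub>R x) ` V"
  then obtain a b where "a \<in> V" "b \<in> V" "v = (1/2) *\<^sub>R a" "w = (1/2) *\<^sub>R b" by auto
  then show "v + w \<in> V"
    using assms convexD[of V a b "1/2" "1/2"] unfolding B_ob_def by auto
qed

definition ob_open :: "'a::ordered_real_vector set \<Rightarrow> bool" where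
  "ob_open U \<longleftrightarrow> (\<forall>x\<in>U. \<exists>V\<in>B_ob. \<forall>v\<in>V. x + v \<in> U)"

lemma istopology_ob_open: "istopology (ob_open :: 'a::ordered_real_vector set \<Rightarrow> bool)"
  unfolding istopology_def
proof (intro conjI allI impI)
  fix S T :: "'a set" assume S: "ob_open S" and T: "ob_open T"
  show "ob_open (S \<inter> T)"
    unfolding ob_open_def
  proof
    fix x assume "x \<in> S \<inter> T"
    then obtain V W where "V \<in> B_ob" "\<forall>v\<in>V. x + v \<in> S" "W \<in> B_ob" "\<forall>v\<in>W. x + v \<in> T"
      using S T unfolding ob_open_def by blast
    then show "\<exists>V\<in>B_ob. \<forall>v\<in>V. x + v \<in> S \<inter> T" using B_ob_Int by blast
  qed
next
  fix K :: "'a set set" assume K: "\<forall>S\<in>K. ob_open S"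
  show "ob_open (\<Union>K)"
    unfolding ob_open_def
  proof
    fix x assume "x \<in> \<Union>K"
    then obtain S where S: "S \<in> K" "x \<in> S" by blast
    then obtain V where "V \<in> B_ob" "\<forall>v\<in>V. x + v \<in> S" using K unfolding ob_open_def by meson
    then show "\<exists>V\<in>B_ob. \<forall>v\<in>V. x + v \<in> \<Union>K" using S(1) by (meson UnionI)
  qed
qed

lemma openin_ob: "openin (topology ob_open) U \<longleftrightarrow> ob_open U"
  by (simp add: istopology_ob_open)

lemma ob_open_nhd:
  assumes "V \<in> B_ob"
  obtains N where "ob_open N" "x \<in> N" "\<And>z. z \<in> N \<Longrightarrow> z - x \<in> V"
proof (rule that)
  let ?N = "{z. \<exists>W\<in>B_ob. \<forall>w\<in>W. z - x + w \<in> V}"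
  show "ob_open ?N"
    unfolding ob_open_def
  proof
    fix z assume "z \<in> ?N"
    then obtain W where W: "W \<in> B_ob" "\<forall>w\<in>W. z - x + w \<in> V" by blast
    obtain H where H: "H \<in> B_ob" "\<And>v w. v \<in> H \<Longrightarrow> w \<in> H \<Longrightarrow> v + w \<in> W"
      using B_ob_half[OF W(1)] by blast
    have "z + v - x + w \<in> V" if "v \<in> H" "w \<in> H" for v w
    proof -
      have "z - x + (v + w) \<in> V" using W(2) H(2)[OF that] by blast
      then show ?thesis by (simp add: algebra_simps)
    qed
    then show "\<exists>V\<in>B_ob. \<forall>v\<in>V. z + v \<in> ?N" using H(1) by blast
  qed
  show "x \<in> ?N" using assms by auto
  show "z - x \<in> V" if "z \<in> ?N" for z
    using that zero_in_B_ob by force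
qed

lemma vector_topology_ob_open:
  "vector_topology (topology (ob_open :: 'a::ordered_real_vector set \<Rightarrow> bool))"
proof -
  let ?T = "topology (ob_open :: 'a set \<Rightarrow> bool)"
  have top: "topspace ?T = UNIV"
  proof -
    have "ob_open (UNIV :: 'a set)" unfolding ob_open_def using B_ob_UNIV by blast
    then show ?thesis using openin_subset[of ?T UNIV] by (auto simp: openin_ob)
  qed
  have add: "continuous_map (prod_topology ?T ?T) ?T (\<lambda>(x, y). x + y)"
    unfolding continuous_map_def openin_prod_topology_alt
  proof (intro conjI allI impI)
    fix U x y assume U: "openin ?T U"
      and xy: "(x, y) \<in> {p \<in> topspace (prod_topology ?T ?T). (case p of (x, y) \<Rightarrow> x + y) \<in> U}"
    then obtain V where V: "V \<in> B_ob" "\<forall>v\<in>V. x + y + v \<in> U" by (auto simp: openin_ob ob_open_def)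
    obtain H where H: "H \<in> B_ob" "\<And>v w. v \<in> H \<Longrightarrow> w \<in> H \<Longrightarrow> v + w \<in> V"
      using B_ob_half[OF V(1)] by blast
    obtain M where M: "ob_open M" "x \<in> M" "\<And>z. z \<in> M \<Longrightarrow> z - x \<in> H" by (rule ob_open_nhd[OF H(1)]) blast
    obtain N where N: "ob_open N" "y \<in> N" "\<And>z. z \<in> N \<Longrightarrow> z - y \<in> H" by (rule ob_open_nhd[OF H(1)]) blast
    have "a + b \<in> U" if "a \<in> M" "b \<in> N" for a b
    proof -
      have "x + y + ((a - x) + (b - y)) \<in> U" using V(2) H(2) M(3) N(3) that by blast
      then show ?thesis by (simp add: algebra_simps)
    qed
    then show "\<exists>M N. openin ?T M \<and> openin ?T N \<and> x \<in> M \<and> y \<in> N \<and>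
        M \<times> N \<subseteq> {p \<in> topspace (prod_topology ?T ?T). (case p of (x, y) \<Rightarrow> x + y) \<in> U}"
      using M N by (intro exI[of _ M] exI[of _ N]) (auto simp: openin_ob top)
  qed (auto simp: top)
  have scale: "continuous_map (prod_topology euclideanreal ?T) ?T (\<lambda>(c, x). c *\<^sub>R x)"
    unfolding continuous_map_def openin_prod_topology_alt
  proof (intro conjI allI impI)
    fix U c x assume U: "openin ?T U"
      and "(c, x) \<in> {p \<in> topspace (prod_topology euclideanreal ?T). (case p of (c, x) \<Rightarrow> c *\<^sub>R x) \<in> U}"
    then obtain V where V: "V \<in> B_ob" "\<forall>v\<in>V. c *\<^sub>R x + v \<in> U" by (auto simp: openin_ob ob_open_def)
    obtain H where H: "H \<in> B_ob" "\<And>v w. v \<in> H \<Longrightarrow> w \<in> H \<Longrightarrow> v + w \<in> V"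
      using B_ob_half[OF V(1)] by blast
    obtain \<mu> where \<mu>: "\<mu> > 0" "\<And>d. \<bar>d\<bar> \<le> \<mu> \<Longrightarrow> d *\<^sub>R x \<in> H" by (rule B_ob_absorbs_point[OF H(1)]) blast
    let ?k = "\<bar>c\<bar> + 1"
    have "(\<lambda>x. (1 / ?k) *\<^sub>R x) ` H \<in> B_ob" using H(1) by (intro B_ob_scale) auto
    then obtain N where N: "ob_open N" "x \<in> N" "\<And>z. z \<in> N \<Longrightarrow> z - x \<in> (\<lambda>x. (1 / ?k) *\<^sub>R x) ` H"
      by (rule ob_open_nhd) blast
    have "d *\<^sub>R z \<in> U" if d: "d \<in> ball c (min \<mu> 1)" and z: "z \<in> N" for d z
    proof -
      obtain h where h: "h \<in> H" "z - x = (1 / ?k) *\<^sub>R h" using N(3)[OF z] by blast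
      have "\<bar>d\<bar> \<le> ?k" using d by (auto simp: dist_real_def)
      then have "\<bar>d / ?k\<bar> \<le> 1" by (simp add: abs_divide)
      then have "(d / ?k) *\<^sub>R h \<in> H" by (rule B_ob_circledD[OF H(1) _ h(1)])
      moreover have "d *\<^sub>R (z - x) = (d / ?k) *\<^sub>R h" using h(2) by simp
      moreover have "(d - c) *\<^sub>R x \<in> H" using d by (intro \<mu>(2)) (auto simp: dist_real_def)
      ultimately have "d *\<^sub>R (z - x) + (d - c) *\<^sub>R x \<in> V" by (intro H(2)) simp_all
      then have "c *\<^sub>R x + (d *\<^sub>R (z - x) + (d - c) *\<^sub>R x) \<in> U" using V(2) by blast
      then show ?thesis by (simp add: algebra_simps)
    qed
    then show "\<exists>M N. openin euclideanreal M \<and> openin ?T N \<and> c \<in> M \<and> x \<in> N \<and>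
        M \<times> N \<subseteq> {p \<in> topspace (prod_topology euclideanreal ?T). (case p of (c, x) \<Rightarrow> c *\<^sub>R x) \<in> U}"
      using N \<mu>(1) by (intro exI[of _ "ball c (min \<mu> 1)"] exI[of _ N]) (auto simp: openin_ob top)
  qed (auto simp: top)
  show ?thesis unfolding vector_topology_def using top add scale by blast
qed

lemma zero_nhds_base_ob_open:
  "has_zero_nhds_base B_ob (topology (ob_open :: 'a::ordered_real_vector set \<Rightarrow> bool))"
proof -
  have nhd: "\<exists>U. ob_open U \<and> 0 \<in> U \<and> U \<subseteq> V" if "V \<in> B_ob" for V :: "'a set"
    by (rule ob_open_nhd[OF that, where x = 0]) auto
  have "\<exists>U V. ob_open U \<and> V \<in> B_ob \<and> 0 \<in> U \<and> U \<subseteq> V \<and> V \<subseteq> W"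
    if W: "ob_open W" "0 \<in> W" for W :: "'a set"
  proof -
    obtain V where "V \<in> B_ob" "\<forall>v\<in>V. 0 + v \<in> W" using W unfolding ob_open_def by meson
    moreover from this obtain U where "ob_open U" "0 \<in> U" "U \<subseteq> V" using nhd by blast
    ultimately show ?thesis by (intro exI[of _ U] exI[of _ V]) auto
  qed
  then show ?thesis
    using nhd unfolding has_zero_nhds_base_def neighbourhood_base_at_def by (simp add: openin_ob)
qed

lemma openin_vector_topology_B_ob:
  assumes T: "vector_topology T" and B: "has_zero_nhds_base B_ob T"
  shows "openin T U \<longleftrightarrow> ob_open U"
proof -
  have top: "topspace T = UNIV" using T unfolding vector_topology_def by blast
  have tr: "continuous_map T T (\<lambda>y. x + y)" for x
  proof -
    have "continuous_map T (prod_topology T T) (\<lambda>y. (x, y))"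
      by (intro continuous_map_pairedI) (auto simp: top)
    then have "continuous_map T T ((\<lambda>(x, y). x + y) \<circ> (\<lambda>y. (x, y)))"
      using T continuous_map_compose unfolding vector_topology_def by blast
    then show ?thesis by (simp add: o_def)
  qed
  have pre: "openin T {y. x + y \<in> S}" if "openin T S" for S x
    using openin_continuous_map_preimage[OF tr that] by (simp add: top)
  show ?thesis
  proof
    assume U: "openin T U"
    show "ob_open U"
      unfolding ob_open_def
    proof
      fix x assume "x \<in> U"
      then have "openin T {y. x + y \<in> U} \<and> 0 \<in> {y. x + y \<in> U}" using pre[OF U] by simp
      then obtain V where "V \<in> B_ob" "V \<subseteq> {y. x + y \<in> U}"
        using B unfolding has_zero_nhds_base_def neighbourhood_base_at_def by metis
      then show "\<exists>V\<in>B_ob. \<forall>v\<in>V. x + v \<in> U" by blast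
    qed
  next
    assume U: "ob_open U"
    show "openin T U"
    proof (subst openin_subopen, intro ballI)
      fix x assume "x \<in> U"
      then obtain V where V: "V \<in> B_ob" "\<forall>v\<in>V. x + v \<in> U" using U unfolding ob_open_def by blast
      then obtain S where S: "openin T S" "0 \<in> S" "S \<subseteq> V" using B unfolding has_zero_nhds_base_def by blast
      have "{y. - x + y \<in> S} \<subseteq> U"
      proof
        fix y assume "y \<in> {y. - x + y \<in> S}"
        then have "x + (- x + y) \<in> U" using S V by blast
        then show "y \<in> U" by simp
      qed
      then show "\<exists>S. openin T S \<and> x \<in> S \<and> S \<subseteq> U"
        using pre[OF S(1), of "- x"] S(2) by (intro exI[of _ "{y. - x + y \<in> S}"]) auto
    qed
  qed
qed

lemma ex1_tau_ob:
  "\<exists>!T :: 'a::ordered_real_vector topology. vector_topology T \<and> has_zero_nhds_base B_ob T"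
proof (rule ex1I)
  show "vector_topology (topology ob_open) \<and> has_zero_nhds_base B_ob (topology ob_open)"
    using vector_topology_ob_open zero_nhds_base_ob_open by blast
  fix T :: "'a topology"
  assume "vector_topology T \<and> has_zero_nhds_base B_ob T"
  then show "T = topology ob_open"
    unfolding topology_eq by (simp add: openin_ob openin_vector_topology_B_ob)
qed

lemma openin_tau_ob:
  fixes U :: "'a::ordered_real_vector set"
  shows "openin tau_ob U \<longleftrightarrow> (\<forall>x\<in>U. \<exists>V\<in>B_ob. \<forall>v\<in>V. x + v \<in> U)"
proof -
  have "vector_topology (tau_ob :: 'a topology) \<and> has_zero_nhds_base B_ob (tau_ob :: 'a topology)"
    unfolding tau_ob_def by (rule theI'[OF ex1_tau_ob])
  then show ?thesis by (simp add: openin_vector_topology_B_ob ob_open_def)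
qed

end

theory Submission
  imports Defs
begin

text \<open>For an order unit \<open>u\<close> every interval \<open>[-ru, ru]\<close> with \<open>r > 0\<close> is a neighbourhood of \<open>0\<close> in the
  order bound topology, and in an Archimedean space the sequence \<open>u / (n + 1)\<close> decreases to \<open>0\<close>;
  so an order open set contains the translate of such an interval to each of its points.
  Conversely, if \<open>y\<close> is net catching and \<open>V\<close> absorbs \<open>[-y, y]\<close>, say \<open>\<mu> [-y, y] \<subseteq> V\<close>, then for a net
  \<open>x\<^sub>\<alpha> \<down> 0\<close> the scaled net \<open>\<mu>\<^sup>-\<^sup>1 x\<^sub>\<alpha>\<close> is eventually below \<open>y\<close>, and hence \<open>[-x\<^sub>\<alpha>, x\<^sub>\<alpha>] \<subseteq> V\<close>.\<close>

text \<open>A negative factor swaps the two endpoints, and a symmetric interval is invariant under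
  this swap; hence the bound involves only the absolute value of \<open>c\<close>.\<close>

lemma scaleR_mem_symmetric_interval:
  fixes v w :: "'a::ordered_real_vector"
  assumes "v \<in> {- w..w}"
  shows "c *\<^sub>R v \<in> {- (\<bar>c\<bar> *\<^sub>R w)..\<bar>c\<bar> *\<^sub>R w}"
proof (cases "0 \<le> c")
  case True
  then have "c *\<^sub>R v \<le> c *\<^sub>R w" "c *\<^sub>R (- w) \<le> c *\<^sub>R v"
    using assms by (auto intro!: scaleR_left_mono simp del: scaleR_minus_right)
  with True show ?thesis by simp
next
  case False
  then have "(- c) *\<^sub>R v \<le> (- c) *\<^sub>R w" "(- c) *\<^sub>R (- w) \<le> (- c) *\<^sub>R v"
    using assms by (auto intro!: scaleR_left_mono simp del: scaleR_minus_right scaleR_minus_left)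
  with False show ?thesis by (simp add: le_minus_iff[of "c *\<^sub>R v"])
qed

lemma symmetric_interval_mono:
  fixes v w :: "'a::ordered_ab_group_add"
  assumes "v \<le> w"
  shows "{- v..v} \<subseteq> {- w..w}"
  using assms by (simp add: atLeastatMost_subset_iff)

text \<open>Being an order unit enters through absorption: multiples of \<open>u\<close> dominate
  both \<open>- a\<close> and \<open>b\<close>, so every order interval lies in a symmetric interval
  around 0 whose endpoints are multiples of \<open>u\<close>.\<close>

lemma order_unit_interval_in_B_ob:
  fixes u :: "'a::ordered_real_vector"
  assumes u: "order_unit u" and r: "r > 0"
  shows "{- (r *\<^sub>R u)..r *\<^sub>R u} \<in> B_ob"
proof -
  let ?V = "{- (r *\<^sub>R u)..r *\<^sub>R u}"
  have u0: "0 \<le> u" using u unfolding order_unit_def by blast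
  \<comment> \<open>Used twice: with \<open>k = r\<close> it gives circledness, with the bound
    \<open>k\<close> of an order interval it gives absorption.\<close>
  have scaled: "c *\<^sub>R v \<in> ?V" if v: "v \<in> {- (k *\<^sub>R u)..k *\<^sub>R u}" and c: "\<bar>c\<bar> * k \<le> r" for c k v
  proof -
    have "\<bar>c\<bar> *\<^sub>R k *\<^sub>R u \<le> r *\<^sub>R u"
      using c u0 by (simp add: scaleR_right_mono)
    from symmetric_interval_mono[OF this] scaleR_mem_symmetric_interval[OF v] show ?thesis by blast
  qed
  have "convex ?V"
  proof (rule convexI)
    fix v w s t
    assume v: "v \<in> ?V" and w: "w \<in> ?V" and st: "(0::real) \<le> s" "0 \<le> t" "s + t = 1"
    have *: "s *\<^sub>R e + t *\<^sub>R e = e" for e :: 'a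
      using st by (simp flip: scaleR_left_distrib)
    have "s *\<^sub>R v + t *\<^sub>R w \<le> s *\<^sub>R (r *\<^sub>R u) + t *\<^sub>R (r *\<^sub>R u)"
      using v w st by (intro add_mono scaleR_left_mono) auto
    moreover have "s *\<^sub>R (- (r *\<^sub>R u)) + t *\<^sub>R (- (r *\<^sub>R u)) \<le> s *\<^sub>R v + t *\<^sub>R w"
      using v w st by (intro add_mono scaleR_left_mono) auto
    ultimately show "s *\<^sub>R v + t *\<^sub>R w \<in> ?V" unfolding * by simp
  qed
  moreover have "circled ?V"
    unfolding circled_def
  proof (intro ballI image_subsetI)
    fix c :: real and v assume "c \<in> {-1..1}" "v \<in> ?V"
    then show "c *\<^sub>R v \<in> ?V" using r by (intro scaled[of v r]) (auto simp: abs_le_iff)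
  qed
  moreover have "absorbs ?V {a..b}" for a b
  proof -
    obtain m n :: nat where m: "- a \<le> real m *\<^sub>R u" and n: "b \<le> real n *\<^sub>R u"
      using u unfolding order_unit_def by blast
    \<comment> \<open>The summand 1 makes \<open>k\<close> positive even if \<open>m\<close> and
      \<open>n\<close> are both 0, so that \<open>r / k\<close> is a valid absorption
      radius.\<close>
    define k where "k = 1 + real m + real n"
    have "real m *\<^sub>R u \<le> k *\<^sub>R u" "real n *\<^sub>R u \<le> k *\<^sub>R u"
      unfolding k_def using u0 by (auto intro: scaleR_right_mono)
    then have "- a \<le> k *\<^sub>R u" "b \<le> k *\<^sub>R u"
      using m n by (blast intro: order_trans)+
    then have "- (k *\<^sub>R u) \<le> a" "b \<le> k *\<^sub>R u"
      by (simp_all add: minus_le_iff)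
    then have sub: "{a..b} \<subseteq> {- (k *\<^sub>R u)..k *\<^sub>R u}"
      by (simp add: atLeastatMost_subset_iff)
    have k: "k > 0" unfolding k_def by simp
    show ?thesis
      unfolding absorbs_def
    proof (intro exI[of _ "r / k"] conjI ballI image_subsetI)
      show "0 < r / k" using r k by simp
      fix c v assume "c \<in> {- (r / k)..r / k}" "v \<in> {a..b}"
      then have "\<bar>c\<bar> \<le> r / k" by (auto simp: abs_le_iff)
      then have "\<bar>c\<bar> * k \<le> r" using k by (simp add: field_simps)
      with sub \<open>v \<in> {a..b}\<close> show "c *\<^sub>R v \<in> ?V" by (blast intro: scaled)
    qed
  qed
  ultimately show ?thesis unfolding B_ob_def by blast
qed

lemma isGlb_UNIV_iff:
  "isGlb UNIV S x \<longleftrightarrow> (\<forall>s\<in>S. x \<le> s) \<and> (\<forall>z. (\<forall>s\<in>S. z \<le> s) \<longrightarrow> z \<le> x)"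
  unfolding isGlb_def greatestP_def isLb_def setge_def setle_def by blast

lemma net_decreasing_to_0_divide_Suc:
  fixes u :: "'a::ordered_real_vector"
  assumes arch: "archimedean_space TYPE('a)" and u: "0 \<le> u"
  shows "net_decreasing_to_0 UNIV {(m, n). m \<le> n} (\<lambda>n. u /\<^sub>R real (Suc n))"
proof -
  have "directed_set UNIV {(m, n :: nat). m \<le> n}"
    unfolding directed_set_def preorder_on_def refl_on_def trans_def
    by (auto intro: max.cobounded1 max.cobounded2)
  moreover have "u /\<^sub>R real (Suc n) \<le> u /\<^sub>R real (Suc m)" if "m \<le> n" for m n
    using that u by (intro scaleR_right_mono le_imp_inverse_le) auto
  moreover have "z \<le> 0" if z: "\<And>n. z \<le> u /\<^sub>R real (Suc n)" for z
  proof -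
    \<comment> \<open>The Archimedean property also asks for \<open>n = 0\<close>, where the claim
      is \<open>0 \<le> u\<close>; for \<open>n = Suc m\<close> it is the lower bound at index
      \<open>m\<close>, multiplied by \<open>n\<close>.\<close>
    have "real n *\<^sub>R z \<le> u" for n
    proof (cases n)
      case (Suc m)
      then show ?thesis using z[of m] by (simp add: pos_le_divideR_eq del: of_nat_Suc)
    qed (use u in simp)
    then show ?thesis using arch unfolding archimedean_space_def by blast
  qed
  ultimately show ?thesis
    using u unfolding net_decreasing_to_0_def isGlb_UNIV_iff
    by (auto intro: scaleR_nonneg_nonneg)
qed

text \<open>Scaling by a positive factor is an order automorphism: if \<open>z\<close> is a lower
  bound of the scaled net, then \<open>c *\<^sub>R z\<close> is one of \<open>f\<close>.\<close>

lemma net_decreasing_to_0_divideR: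
  fixes f :: "'i \<Rightarrow> 'a::ordered_real_vector"
  assumes net: "net_decreasing_to_0 A r f" and c: "c > 0"
  shows "net_decreasing_to_0 A r (\<lambda>\<alpha>. f \<alpha> /\<^sub>R c)"
proof -
  have f0: "0 \<le> f \<alpha>" if "\<alpha> \<in> A" for \<alpha>
    using net that unfolding net_decreasing_to_0_def isGlb_UNIV_iff by blast
  have "z \<le> 0" if "\<forall>\<alpha>\<in>A. z \<le> f \<alpha> /\<^sub>R c" for z
  proof -
    have "\<forall>\<alpha>\<in>A. c *\<^sub>R z \<le> f \<alpha>"
      using that c by (simp add: pos_le_divideR_eq)
    then have "c *\<^sub>R z \<le> 0"
      using net unfolding net_decreasing_to_0_def isGlb_UNIV_iff by blast
    then show ?thesis using c by (simp add: scaleR_le_0_iff)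
  qed
  moreover have "f \<beta> /\<^sub>R c \<le> f \<alpha> /\<^sub>R c" if "(\<alpha>, \<beta>) \<in> r" for \<alpha> \<beta>
    using net that c unfolding net_decreasing_to_0_def by (intro scaleR_left_mono) auto
  ultimately show ?thesis
    using net f0 c unfolding net_decreasing_to_0_def isGlb_UNIV_iff
    by (auto intro: scaleR_nonneg_nonneg)
qed

lemma order_open_imp_openin_tau_ob:
  fixes U :: "'a::ordered_real_vector set"
  assumes arch: "archimedean_space TYPE('a)" and u: "order_unit (u :: 'a)" and U: "order_open U"
  shows "openin tau_ob U"
  unfolding openin_tau_ob
proof
  fix x assume "x \<in> U"
  then have "net_catching_for U x" using U unfolding order_open_def by blast
  moreover have "net_decreasing_to_0 UNIV {(m, n). m \<le> n} (\<lambda>n. u /\<^sub>R real (Suc n))"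
    using arch u by (intro net_decreasing_to_0_divide_Suc) (auto simp: order_unit_def)
  \<comment> \<open>This net is indexed by natural numbers instead of elements of the space, hence
    the transfer by \<open>net_catching_forD\<close>.\<close>
  ultimately obtain n where n: "{x - u /\<^sub>R real (Suc n)..x + u /\<^sub>R real (Suc n)} \<subseteq> U"
    using net_catching_forD by blast
  have "{- (u /\<^sub>R real (Suc n))..u /\<^sub>R real (Suc n)} \<in> B_ob"
    by (rule order_unit_interval_in_B_ob[OF u]) simp
  moreover have "x + v \<in> U" if "v \<in> {- (u /\<^sub>R real (Suc n))..u /\<^sub>R real (Suc n)}" for v
  proof -
    have "x + - (u /\<^sub>R real (Suc n)) \<le> x + v" "x + v \<le> x + u /\<^sub>R real (Suc n)"
      using that by (auto intro: add_left_mono simp del: of_nat_Suc)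
    then show ?thesis using n by (auto simp del: of_nat_Suc)
  qed
  ultimately show "\<exists>V\<in>B_ob. \<forall>v\<in>V. x + v \<in> U" by blast
qed

lemma openin_tau_ob_imp_order_open:
  fixes U :: "'a::ordered_real_vector set"
  assumes y: "net_catching_element (y :: 'a)" and U: "openin tau_ob U"
  shows "order_open U"
  unfolding order_open_def net_catching_for_def
proof (intro ballI allI impI)
  fix x A r and f :: "'a \<Rightarrow> 'a"
  assume "x \<in> U" and net: "net_decreasing_to_0 A r f"
  then obtain V where V: "V \<in> B_ob" "\<And>v. v \<in> V \<Longrightarrow> x + v \<in> U"
    using U unfolding openin_tau_ob by blast
  have "absorbs V {- y..y}" using V(1) unfolding B_ob_def by blast
  then obtain \<mu> where \<mu>: "\<mu> > 0" "\<And>c. c \<in> {-\<mu>..\<mu>} \<Longrightarrow> (\<lambda>v. c *\<^sub>R v) ` {- y..y} \<subseteq> V"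
    unfolding absorbs_def by blast
  have \<mu>V: "\<mu> *\<^sub>R v \<in> V" if "v \<in> {- y..y}" for v
    using \<mu>(1) \<mu>(2)[of \<mu>] that by auto
  \<comment> \<open>The net is divided by \<open>\<mu>\<close> before \<open>y\<close> catches it,
    because only the multiple of \<open>[-y, y]\<close> by \<open>\<mu>\<close> is known to lie in
    \<open>V\<close>.\<close>
  obtain \<alpha> where \<alpha>: "\<alpha> \<in> A" "f \<alpha> /\<^sub>R \<mu> \<le> y"
    using net_catching_elementD[OF y net_decreasing_to_0_divideR[OF net \<mu>(1)]] by blast
  have "w \<in> U" if "w \<in> {x - f \<alpha>..x + f \<alpha>}" for w
  proof -
    have "w - x \<in> {- f \<alpha>..f \<alpha>}"
      using that by (auto simp: algebra_simps)
    \<comment> \<open>Division by \<open>\<mu>\<close> brings \<open>w - x\<close> into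
      \<open>[-y, y]\<close>; multiplying back by \<open>\<mu>\<close> then lands in
      \<open>V\<close>.\<close>
    then have "(w - x) /\<^sub>R \<mu> \<in> {- (f \<alpha> /\<^sub>R \<mu>)..f \<alpha> /\<^sub>R \<mu>}"
      using scaleR_mem_symmetric_interval[of "w - x" "f \<alpha>" "inverse \<mu>"] \<mu>(1) by simp
    then have "\<mu> *\<^sub>R ((w - x) /\<^sub>R \<mu>) \<in> V"
      using symmetric_interval_mono[OF \<alpha>(2)] by (intro \<mu>V) blast
    then have "x + (w - x) \<in> U" using \<mu>(1) by (intro V(2)) simp
    then show ?thesis by simp
  qed
  with \<alpha>(1) show "\<exists>\<alpha>\<in>A. {x - f \<alpha>..x + f \<alpha>} \<subseteq> U" by blast
qed

theorem theorem7p11: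
  shows "(archimedean_space TYPE('a::ordered_real_vector) \<and> (\<exists>u :: 'a. order_unit u) \<longrightarrow>
            {U :: 'a set. openin tau_o U} \<subseteq> {U. openin tau_ob U}) \<and>
         ((\<exists>y :: 'a. net_catching_element y) \<longrightarrow>
            {U :: 'a set. openin tau_ob U} \<subseteq> {U. openin tau_o U})"
  unfolding openin_tau_o
  using order_open_imp_openin_tau_ob openin_tau_ob_imp_order_open by blast

end
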